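(* Let $\alpha\in(0,1)$ and let $E,B,\rho,J$ have coefficients in $\mathscr{P}_\alpha(U_{\mathrm{st}})$, with associated Faraday $2$-form $F$ and current $3$-form $\mathcal{J}$. If $(F,\mathcal{J})$ satisfies the Lorentzian coframe-attached fractional Maxwell system $$d^\alpha F=0,\qquad d^\alpha(\star_\alpha F)=\mathcal{J},$$ then $$d^\alpha\mathcal{J}=0.$$ Equivalently, $$\mathsf{D}_t^\alpha\rho+\operatorname{div}_\alpha J=0.$$
   Context: Let $U_{\mathrm{st}}=[0,T]\times[0,b_1]\times[0,b_2]\times[0,b_3]$ ($T,b_i>0$) with coordinates $(t,x_1,x_2,x_3)$, $\Theta^\alpha=t^\alpha/\Gamma(1+\alpha)$, $X_i^\alpha=x_i^\alpha/\Gamma(1+\alpha)$, and $\mathscr{P}_\alpha(U_{\mathrm{st}})=\mathbb{R}[\Theta^\alpha,X_1^\alpha,X_2^\alpha,X_3^\alpha]$ (these four functions are algebraically independent). Write $Z_0=\Theta^\alpha$, $Z_i=X_i^\alpha$. The polynomial Caputo operators $\mathsf{D}_\mu^\alpha$, $\mu=0,1,2,3$ (with $\mathsf{D}_t^\alpha:=\mathsf{D}_0^\alpha$), are the $\mathbb{R}$-linear maps on $\mathscr{P}_\alpha(U_{\mathrm{st}})$ with $$\mathsf{D}_\mu^\alpha\prod_\nu Z_\nu^{m_\nu}=\frac{\Gamma(m_\mu\alpha+1)}{\Gamma((m_\mu-1)\alpha+1)\Gamma(1+\alpha)}Z_\mu^{m_\mu-1}\prod_{\nu\ne\mu}Z_\nu^{m_\nu}$$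 if $m_\mu\ge1$, and $0$ if $m_\mu=0$. Let $e^0=d^\alpha\Theta$, $e^i=d^\alpha X_i$ ($i=1,2,3$) be formal anticommuting degree-one generators ($e^\mu\wedge e^\nu=-e^\nu\wedge e^\mu$, $e^\mu\wedge e^\mu=0$), $e^{\mu\nu}=e^\mu\wedge e^\nu$, $e^{\mu\nu\lambda}=e^\mu\wedge e^\nu\wedge e^\lambda$; forms are elements of the exterior algebra $\Omega_\alpha^\bullet(U_{\mathrm{st}};\mathscr{P}_\alpha)$ on these generators over $\mathscr{P}_\alpha(U_{\mathrm{st}})$, and $d^\alpha(\sum_I a_Ie^I)=\sum_I\sum_{\mu=0}^3(\mathsf{D}_\mu^\alpha a_I)\,e^\mu\wedge e^I$. For spatial fields $V=(V_1,V_2,V_3)$, $\operatorname{div}_\alpha V=\sum_{i=1}^3\mathsf{D}_i^\alpha V_i$. For $E=(E_1,E_2,E_3)$, $B=(B_1,B_2,B_3)$, $\rho$, $J=(J_1,J_2,J_3)$ with coefficients in $\mathscr{P}_\alpha(U_{\mathrm{st}})$ define $$F=-E_1e^{01}-E_2e^{02}-E_3e^{03}+B_1e^{23}-B_2e^{13}+B_3e^{12},$$ $$\mathcal{J}=\rho\,e^{123}-J_1e^{023}+J_2e^{013}-J_3e^{012}.$$ The Hodge-type operator $\star_\alpha$ is the $\mathscr{P}_\alpha(U_{\mathrm{st}})$-linear map on $2$-forms with $\star_\alpha e^{01}=-e^{23}$, $\star_\alpha e^{02}=e^{13}$, $\star_\alpha e^{03}=-e^{12}$, $\star_\alpha e^{23}=e^{01}$,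 $\star_\alpha e^{13}=-e^{02}$, $\star_\alpha e^{12}=e^{03}$. *)

theory Defs
  imports "HOL-Analysis.Analysis" "HOL-Library.Function_Algebras" "HOL-Library.Poly_Mapping"
begin

text \<open>
  Points of spacetime are vectors of type \<^typ>\<open>real^4\<close>; the indices of type \<^typ>\<open>4\<close>
  are the residues 0, 1, 2, 3, ordered in this way, so that \<open>x $ 0\<close> is the time coordinate \<open>t\<close>.
  A scalar field is a function on \<^typ>\<open>real^4\<close> of which only the restriction to the box
  matters, and equality of fields is always equality on the box.
\<close>

type_synonym scalar_field = "real^4 \<Rightarrow> real"

definition spacetime_box :: "real \<Rightarrow> real \<Rightarrow> real \<Rightarrow> real \<Rightarrow> (real^4) set" where
  "spacetime_box T b\<^sub>1 b\<^sub>2 b\<^sub>3 =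
     {x. x $ 0 \<in> {0..T} \<and> x $ 1 \<in> {0..b\<^sub>1} \<and> x $ 2 \<in> {0..b\<^sub>2} \<and> x $ 3 \<in> {0..b\<^sub>3}}"

definition frac_coord :: "real \<Rightarrow> 4 \<Rightarrow> scalar_field" where
  "frac_coord \<alpha> \<mu> x = (x $ \<mu>) powr \<alpha> / Gamma (1 + \<alpha>)"

definition frac_monomial :: "real \<Rightarrow> nat^4 \<Rightarrow> scalar_field" where
  "frac_monomial \<alpha> m x = (\<Prod>\<nu>\<in>UNIV. frac_coord \<alpha> \<nu> x ^ (m $ \<nu>))"

text \<open>A polynomial in four indeterminates is the finitely supported family of its coefficients,
  indexed by exponent vectors.\<close>

definition frac_poly :: "real \<Rightarrow> ((nat^4) \<Rightarrow>\<^sub>0 real) \<Rightarrow> scalar_field" where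
  "frac_poly \<alpha> p x = (\<Sum>m\<in>Poly_Mapping.keys p. Poly_Mapping.lookup p m * frac_monomial \<alpha> m x)"

definition frac_poly_algebra :: "real \<Rightarrow> (real^4) set \<Rightarrow> scalar_field set" where
  "frac_poly_algebra \<alpha> U = {f. \<exists>p. \<forall>x\<in>U. f x = frac_poly \<alpha> p x}"

definition caputo_monomial :: "real \<Rightarrow> 4 \<Rightarrow> nat^4 \<Rightarrow> scalar_field" where
  "caputo_monomial \<alpha> \<mu> m x =
     (if m $ \<mu> = 0 then 0
      else Gamma (real (m $ \<mu>) * \<alpha> + 1)
             / (Gamma ((real (m $ \<mu>) - 1) * \<alpha> + 1) * Gamma (1 + \<alpha>))
           * frac_coord \<alpha> \<mu> x ^ (m $ \<mu> - 1)
           * (\<Prod>\<nu>\<in>UNIV - {\<mu>}. frac_coord \<alpha> \<nu> x ^ (m $ \<nu>)))"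

text \<open>The representing polynomial is unique by algebraic independence, which is
  \<open>frac_poly_unique\<close> below; the characterisation of the operator as the linear map with the
  prescribed values on monomials is \<open>caputo_monomial_eq\<close>, \<open>caputo_add\<close> and \<open>caputo_scale\<close>.\<close>

definition caputo :: "real \<Rightarrow> (real^4) set \<Rightarrow> 4 \<Rightarrow> scalar_field \<Rightarrow> scalar_field" where
  "caputo \<alpha> U \<mu> f x =
     (let p = (THE p. \<forall>y\<in>U. f y = frac_poly \<alpha> p y)
      in \<Sum>m\<in>Poly_Mapping.keys p. Poly_Mapping.lookup p m * caputo_monomial \<alpha> \<mu> m x)"

definition frac_div :: "real \<Rightarrow> (real^4) set \<Rightarrow> scalar_field^3 \<Rightarrow> scalar_field" where
  "frac_div \<alpha> U V = caputo \<alpha> U 1 (V $ 1) + caputo \<alpha> U 2 (V $ 2) + caputo \<alpha> U 3 (V $ 3)"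

text \<open>A form is the family of its coefficients \<open>\<omega> I\<close> with respect to the basis \<open>e\<^sup>I\<close>, the wedge
  product of the generators \<open>e\<^sup>\<mu>\<close> with \<open>\<mu> \<in> I\<close> taken in increasing order. Addition,
  negation and zero are the pointwise ones.\<close>

type_synonym form = "4 set \<Rightarrow> scalar_field"

definition form_eq_on :: "(real^4) set \<Rightarrow> form \<Rightarrow> form \<Rightarrow> bool" where
  "form_eq_on U \<omega> \<eta> \<longleftrightarrow> (\<forall>I. \<forall>x\<in>U. \<omega> I x = \<eta> I x)"

definition form_scale :: "scalar_field \<Rightarrow> form \<Rightarrow> form" (infixr "\<odot>" 72) where
  "f \<odot> \<omega> = (\<lambda>I. f * \<omega> I)"

definition basis_form :: "4 set \<Rightarrow> form" where
  "basis_form I = (\<lambda>K. if K = I then 1 else 0)"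

text \<open>For disjoint \<open>I\<close> and \<open>J\<close>, the sign of the permutation that sorts the elements of \<open>I\<close> (in
  increasing order) followed by those of \<open>J\<close> (in increasing order).\<close>

definition shuffle_sign :: "4 set \<Rightarrow> 4 set \<Rightarrow> real" where
  "shuffle_sign I J = (-1) ^ card {(i, j). i \<in> I \<and> j \<in> J \<and> j < i}"

definition wedge :: "form \<Rightarrow> form \<Rightarrow> form" (infixr "\<^bold>\<and>" 75) where
  "(\<omega> \<^bold>\<and> \<eta>) K = (\<lambda>x. \<Sum>I\<in>Pow K. shuffle_sign I (K - I) * \<omega> I x * \<eta> (K - I) x)"

definition gen :: "4 \<Rightarrow> form" ("\<e>") where
  "\<e> \<mu> = basis_form {\<mu>}"

definition frac_d :: "real \<Rightarrow> (real^4) set \<Rightarrow> form \<Rightarrow> form" where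
  "frac_d \<alpha> U \<omega> = (\<Sum>I\<in>UNIV. \<Sum>\<mu>\<in>UNIV. caputo \<alpha> U \<mu> (\<omega> I) \<odot> (\<e> \<mu> \<^bold>\<and> basis_form I))"

definition faraday :: "scalar_field^3 \<Rightarrow> scalar_field^3 \<Rightarrow> form" where
  "faraday E B =
     - (E $ 1) \<odot> (\<e> 0 \<^bold>\<and> \<e> 1) - (E $ 2) \<odot> (\<e> 0 \<^bold>\<and> \<e> 2) - (E $ 3) \<odot> (\<e> 0 \<^bold>\<and> \<e> 3)
     + (B $ 1) \<odot> (\<e> 2 \<^bold>\<and> \<e> 3) - (B $ 2) \<odot> (\<e> 1 \<^bold>\<and> \<e> 3) + (B $ 3) \<odot> (\<e> 1 \<^bold>\<and> \<e> 2)"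

definition current :: "scalar_field \<Rightarrow> scalar_field^3 \<Rightarrow> form" where
  "current \<rho> J =
     \<rho> \<odot> (\<e> 1 \<^bold>\<and> \<e> 2 \<^bold>\<and> \<e> 3) - (J $ 1) \<odot> (\<e> 0 \<^bold>\<and> \<e> 2 \<^bold>\<and> \<e> 3)
     + (J $ 2) \<odot> (\<e> 0 \<^bold>\<and> \<e> 1 \<^bold>\<and> \<e> 3) - (J $ 3) \<odot> (\<e> 0 \<^bold>\<and> \<e> 1 \<^bold>\<and> \<e> 2)"

text \<open>Defined on all forms; the components of degree other than 2 are discarded.\<close>

definition hodge2 :: "form \<Rightarrow> form" where
  "hodge2 \<omega> =
     \<omega> {0, 1} \<odot> (- (\<e> 2 \<^bold>\<and> \<e> 3)) + \<omega> {0, 2} \<odot> (\<e> 1 \<^bold>\<and> \<e> 3) + \<omega> {0, 3} \<odot> (- (\<e> 1 \<^bold>\<and> \<e> 2))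
     + \<omega> {2, 3} \<odot> (\<e> 0 \<^bold>\<and> \<e> 1) + \<omega> {1, 3} \<odot> (- (\<e> 0 \<^bold>\<and> \<e> 2)) + \<omega> {1, 2} \<odot> (\<e> 0 \<^bold>\<and> \<e> 3)"

lemma index4_order: "(0::4) < 1" "(1::4) < 2" "(2::4) < 3"
  by (simp_all add: less_bit0_def bit0.Rep_0 bit0.Rep_1 bit0.Rep_numeral)

lemma index4_UNIV: "(UNIV :: 4 set) = {0, 1, 2, 3}"
  using UNIV_4 by auto

lemma basis_wedge_basis:
  "basis_form I \<^bold>\<and> basis_form J =
     (if I \<inter> J = {} then (\<lambda>_. shuffle_sign I J) \<odot> basis_form (I \<union> J) else 0)"
proof (intro ext)
  fix K x
  have "(basis_form I \<^bold>\<and> basis_form J) K x =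
      (\<Sum>I'\<in>Pow K. if I' = I then (if K - I = J then shuffle_sign I J else 0) else 0)"
    unfolding wedge_def by (intro sum.cong) (auto simp: basis_form_def)
  also have "\<dots> = (if I \<subseteq> K \<and> K - I = J then shuffle_sign I J else 0)"
    by (simp add: sum.delta)
  also have "I \<subseteq> K \<and> K - I = J \<longleftrightarrow> I \<inter> J = {} \<and> K = I \<union> J" by blast
  finally show "(basis_form I \<^bold>\<and> basis_form J) K x =
     (if I \<inter> J = {} then (\<lambda>_. shuffle_sign I J) \<odot> basis_form (I \<union> J) else 0) K x"
    by (auto simp: form_scale_def basis_form_def)
qed

lemma gen_wedge_self: "\<e> \<mu> \<^bold>\<and> \<e> \<mu> = 0"
  by (simp add: gen_def basis_wedge_basis)

lemma gen_wedge_gen: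
  assumes "\<mu> < \<nu>"
  shows "\<e> \<mu> \<^bold>\<and> \<e> \<nu> = basis_form {\<mu>, \<nu>}" "\<e> \<nu> \<^bold>\<and> \<e> \<mu> = - basis_form {\<mu>, \<nu>}"
proof -
  have "{(i, j). i \<in> {\<mu>} \<and> j \<in> {\<nu>} \<and> j < i} = {}"
    "{(i, j). i \<in> {\<nu>} \<and> j \<in> {\<mu>} \<and> j < i} = {(\<nu>, \<mu>)}"
    using assms by auto
  then have "shuffle_sign {\<mu>} {\<nu>} = 1" "shuffle_sign {\<nu>} {\<mu>} = -1"
    by (simp_all only: shuffle_sign_def) simp_all
  then show "\<e> \<mu> \<^bold>\<and> \<e> \<nu> = basis_form {\<mu>, \<nu>}" "\<e> \<nu> \<^bold>\<and> \<e> \<mu> = - basis_form {\<mu>, \<nu>}"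
    using assms by (auto simp: gen_def basis_wedge_basis form_scale_def fun_eq_iff insert_commute)
qed

lemma gen_wedge_anticomm: "\<e> \<mu> \<^bold>\<and> \<e> \<nu> = - (\<e> \<nu> \<^bold>\<and> \<e> \<mu>)"
proof (cases \<mu> \<nu> rule: linorder_cases)
  case less then show ?thesis by (simp add: gen_wedge_gen)
next
  case equal then show ?thesis by (simp add: gen_wedge_self fun_eq_iff)
next
  case greater then show ?thesis by (simp add: gen_wedge_gen)
qed

lemma gen_wedge_gen_gen:
  assumes "\<mu> < \<nu>" "\<nu> < \<kappa>"
  shows "\<e> \<mu> \<^bold>\<and> \<e> \<nu> \<^bold>\<and> \<e> \<kappa> = basis_form {\<mu>, \<nu>, \<kappa>}"
proof -
  have "{(i, j). i \<in> {\<mu>} \<and> j \<in> {\<nu>, \<kappa>} \<and> j < i} = {}" using assms by auto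
  then have "shuffle_sign {\<mu>} {\<nu>, \<kappa>} = 1" by (simp only: shuffle_sign_def) simp
  then show ?thesis
    using assms by (auto simp: gen_wedge_gen gen_def[of \<mu>] basis_wedge_basis form_scale_def fun_eq_iff insert_commute)
qed

lemma hodge2_gen:
  "hodge2 (\<e> 0 \<^bold>\<and> \<e> 1) = - (\<e> 2 \<^bold>\<and> \<e> 3)" "hodge2 (\<e> 0 \<^bold>\<and> \<e> 2) = \<e> 1 \<^bold>\<and> \<e> 3"
  "hodge2 (\<e> 0 \<^bold>\<and> \<e> 3) = - (\<e> 1 \<^bold>\<and> \<e> 2)" "hodge2 (\<e> 2 \<^bold>\<and> \<e> 3) = \<e> 0 \<^bold>\<and> \<e> 1"
  "hodge2 (\<e> 1 \<^bold>\<and> \<e> 3) = - (\<e> 0 \<^bold>\<and> \<e> 2)" "hodge2 (\<e> 1 \<^bold>\<and> \<e> 2) = \<e> 0 \<^bold>\<and> \<e> 3"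
proof -
  have lt: "(0::4) < 1" "(0::4) < 2" "(0::4) < 3" "(1::4) < 2" "(1::4) < 3" "(2::4) < 3"
    using index4_order by (auto intro: less_trans)
  show "hodge2 (\<e> 0 \<^bold>\<and> \<e> 1) = - (\<e> 2 \<^bold>\<and> \<e> 3)" "hodge2 (\<e> 0 \<^bold>\<and> \<e> 2) = \<e> 1 \<^bold>\<and> \<e> 3"
    "hodge2 (\<e> 0 \<^bold>\<and> \<e> 3) = - (\<e> 1 \<^bold>\<and> \<e> 2)" "hodge2 (\<e> 2 \<^bold>\<and> \<e> 3) = \<e> 0 \<^bold>\<and> \<e> 1"
    "hodge2 (\<e> 1 \<^bold>\<and> \<e> 3) = - (\<e> 0 \<^bold>\<and> \<e> 2)" "hodge2 (\<e> 1 \<^bold>\<and> \<e> 2) = \<e> 0 \<^bold>\<and> \<e> 3"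
    by (simp_all add: hodge2_def lt gen_wedge_gen, simp_all add: form_scale_def basis_form_def
        fun_eq_iff doubleton_eq_iff)
qed

lemma poly_independent:
  fixes c :: "('a \<Rightarrow> nat) \<Rightarrow> real" and b :: "'a \<Rightarrow> real"
  assumes "finite A" "finite S" "\<And>i. i \<in> A \<Longrightarrow> b i > 0"
    and "\<And>m i. m \<in> S \<Longrightarrow> i \<notin> A \<Longrightarrow> m i = 0"
    and "\<And>z. (\<And>i. i \<in> A \<Longrightarrow> z i \<in> {0..b i}) \<Longrightarrow> (\<Sum>m\<in>S. c m * (\<Prod>i\<in>A. z i ^ m i)) = 0"
    and "m \<in> S"
  shows "c m = 0"
  using assms
proof (induction A arbitrary: S c m rule: finite_induct)
  case empty
  have "S \<subseteq> {\<lambda>_. 0}" using empty.prems(3) by auto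
  then have "S = {m}" "m = (\<lambda>_. 0)" using empty.prems(5) by auto
  then show ?case using empty.prems(4)[of "\<lambda>_. 0"] by simp
next
  case (insert a A)
  define k where "k = m a"
  define S' where "S' = (\<lambda>m. m(a := 0)) ` {m \<in> S. m a = k}"
  define c' where "c' = (\<lambda>m. c (m(a := k)))"
  have inj: "inj_on (\<lambda>m. m(a := 0::nat)) {m \<in> S. m a = k}"
    by (rule inj_onI) (metis (mono_tags, lifting) fun_upd_triv fun_upd_upd mem_Collect_eq)
  have "c' (m(a := 0)) = 0"
  proof (rule insert.IH)
    show "finite S'" using insert.prems(1) by (simp add: S'_def)
    show "b i > 0" if "i \<in> A" for i using insert.prems(2) that by simp
    show "m' i = 0" if "m' \<in> S'" "i \<notin> A" for m' i
      using that insert.prems(3) by (auto simp: S'_def)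
    show "m(a := 0) \<in> S'" using insert.prems(5) by (auto simp: S'_def k_def)
    fix z :: "'a \<Rightarrow> real" assume z: "\<And>i. i \<in> A \<Longrightarrow> z i \<in> {0..b i}"
    define n where "n = Max ((\<lambda>m. m a) ` S)"
    define g where "g = (\<lambda>j. \<Sum>m\<in>{m\<in>S. m a = j}. c m * (\<Prod>i\<in>A. z i ^ m i))"
    have bound: "m a \<le> n" if "m \<in> S" for m
      using that insert.prems(1) by (auto simp: n_def)
    have "(\<Sum>j\<le>n. g j * w ^ j) = 0" if w: "w \<in> {0..b a}" for w
    proof -
      have "0 = (\<Sum>m\<in>S. c m * (\<Prod>i\<in>insert a A. (z(a := w)) i ^ m i))"
        using z w insert.hyps by (intro insert.prems(4)[symmetric]) auto
      also have "\<dots> = (\<Sum>m\<in>S. (c m * (\<Prod>i\<in>A. z i ^ m i)) * w ^ m a)"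
      proof (rule sum.cong[OF refl])
        fix m assume "m \<in> S"
        have "(\<Prod>i\<in>A. (z(a := w)) i ^ m i) = (\<Prod>i\<in>A. z i ^ m i)"
          using insert.hyps by (intro prod.cong) auto
        then show "c m * (\<Prod>i\<in>insert a A. (z(a := w)) i ^ m i)
            = (c m * (\<Prod>i\<in>A. z i ^ m i)) * w ^ m a"
          using insert.hyps by simp
      qed
      also have "\<dots> = (\<Sum>j\<le>n. \<Sum>m\<in>{m\<in>S. m a = j}. (c m * (\<Prod>i\<in>A. z i ^ m i)) * w ^ m a)"
        using bound insert.prems(1) by (intro sum.group[symmetric]) auto
      also have "\<dots> = (\<Sum>j\<le>n. g j * w ^ j)"
        by (intro sum.cong) (auto simp: g_def sum_distrib_right)
      finally show ?thesis by simp
    qed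
    then have "{0..b a} \<subseteq> {w. (\<Sum>j\<le>n. g j * w ^ j) = 0}" by blast
    then have "infinite {w. (\<Sum>j\<le>n. g j * w ^ j) = 0}"
      using insert.prems(2)[of a] by (auto dest: finite_subset simp: infinite_Icc)
    then have "g k = 0"
      using polyfun_finite_roots[of g n] bound[OF insert.prems(5)] k_def by blast
    moreover have "(\<Sum>m\<in>S'. c' m * (\<Prod>i\<in>A. z i ^ m i)) = g k"
      unfolding S'_def sum.reindex[OF inj] g_def comp_def
    proof (rule sum.cong[OF refl])
      fix m assume m: "m \<in> {m \<in> S. m a = k}"
      have "(\<Prod>i\<in>A. z i ^ (m(a := 0)) i) = (\<Prod>i\<in>A. z i ^ m i)"
        using insert.hyps by (intro prod.cong) auto
      moreover have "c' (m(a := 0)) = c m" using m by (auto simp: c'_def)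
      ultimately show "c' (m(a := 0)) * (\<Prod>i\<in>A. z i ^ (m(a := 0)) i) = c m * (\<Prod>i\<in>A. z i ^ m i)"
        by simp
    qed
    ultimately show "(\<Sum>m\<in>S'. c' m * (\<Prod>i\<in>A. z i ^ m i)) = 0" by simp
  qed
  then show ?case by (simp add: c'_def k_def)
qed

lemma frac_poly_superset:
  assumes "finite S" "Poly_Mapping.keys p \<subseteq> S"
  shows "frac_poly \<alpha> p x = (\<Sum>m\<in>S. Poly_Mapping.lookup p m * frac_monomial \<alpha> m x)"
  unfolding frac_poly_def using assms
  by (intro sum.mono_neutral_left) (auto simp: in_keys_iff)

lemma frac_poly_add: "frac_poly \<alpha> (p + q) x = frac_poly \<alpha> p x + frac_poly \<alpha> q x"
proof -
  have "Poly_Mapping.keys (p + q) \<subseteq> Poly_Mapping.keys p \<union> Poly_Mapping.keys q" by (rule Poly_Mapping.keys_add)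
  then show ?thesis
    by (simp add: frac_poly_superset[where S = "Poly_Mapping.keys p \<union> Poly_Mapping.keys q"] lookup_add algebra_simps sum.distrib)
qed

lemma frac_poly_minus: "frac_poly \<alpha> (p - q) x = frac_poly \<alpha> p x - frac_poly \<alpha> q x"
  using frac_poly_add[of \<alpha> "p - q" q x] by simp

theorem frac_poly_unique:
  assumes "\<alpha> > 0" "T > 0" "b\<^sub>1 > 0" "b\<^sub>2 > 0" "b\<^sub>3 > 0"
    and eq: "\<forall>x\<in>spacetime_box T b\<^sub>1 b\<^sub>2 b\<^sub>3. frac_poly \<alpha> p x = frac_poly \<alpha> q x"
  shows "p = q"
proof -
  let ?U = "spacetime_box T b\<^sub>1 b\<^sub>2 b\<^sub>3"
  define L :: "4 \<Rightarrow> real" where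
    "L = (\<lambda>\<nu>. if \<nu> = 0 then T else if \<nu> = 1 then b\<^sub>1 else if \<nu> = 2 then b\<^sub>2 else b\<^sub>3)"
  define G where "G = Gamma (1 + \<alpha>)"
  have G: "G > 0" using assms by (simp add: G_def Gamma_real_pos)
  have L: "L \<nu> > 0" for \<nu> using assms by (simp add: L_def)
  define r where "r = p - q"
  have "Poly_Mapping.lookup r m = 0" if m: "m \<in> Poly_Mapping.keys r" for m
  proof -
    have injv: "inj_on vec_nth (Poly_Mapping.keys r)" by (auto intro!: inj_onI simp: vec_eq_iff)
    have "(\<lambda>n. Poly_Mapping.lookup r (vec_lambda n)) (vec_nth m) = 0"
    proof (rule poly_independent[where A = UNIV and S = "vec_nth ` Poly_Mapping.keys r"
          and b = "\<lambda>\<nu>. L \<nu> powr \<alpha> / G"])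
      show "L i powr \<alpha> / G > 0" for i
        using L[of i] G by simp
      fix z :: "4 \<Rightarrow> real" assume z: "\<And>i. i \<in> UNIV \<Longrightarrow> z i \<in> {0..L i powr \<alpha> / G}"
      define x :: "real^4" where "x = (\<chi> i. (z i * G) powr (1 / \<alpha>))"
      have zx: "frac_coord \<alpha> i x = z i" for i
        using z[of i] G assms(1) by (simp add: frac_coord_def x_def powr_powr G_def[symmetric])
      have "x $ i \<in> {0..L i}" for i
      proof -
        have "z i * G \<le> L i powr \<alpha>" "0 \<le> z i * G" using z[of i] G by (auto simp: field_simps)
        then have "(z i * G) powr (1 / \<alpha>) \<le> (L i powr \<alpha>) powr (1 / \<alpha>)"
          using assms(1) by (intro powr_mono2) auto
        then show ?thesis using assms(1) L[of i] by (simp add: x_def powr_powr)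
      qed
      from this[of 0] this[of 1] this[of 2] this[of 3]
      have "x \<in> ?U" by (simp add: spacetime_box_def L_def)
      then have "frac_poly \<alpha> r x = 0" using eq by (simp add: r_def frac_poly_minus)
      then show "(\<Sum>m\<in>vec_nth ` Poly_Mapping.keys r. Poly_Mapping.lookup r (vec_lambda m) * (\<Prod>i\<in>UNIV. z i ^ m i)) = 0"
        by (simp add: sum.reindex[OF injv] frac_poly_def frac_monomial_def zx)
    qed (use m in auto)
    then show ?thesis by simp
  qed
  then have "Poly_Mapping.keys r = {}" by (meson ex_in_conv in_keys_iff)
  then show ?thesis by (simp add: r_def)
qed

context
  fixes \<alpha> T b\<^sub>1 b\<^sub>2 b\<^sub>3 :: real and U :: "(real^4) set"
  assumes pos: "\<alpha> > 0" "T > 0" "b\<^sub>1 > 0" "b\<^sub>2 > 0" "b\<^sub>3 > 0"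
    and U: "U = spacetime_box T b\<^sub>1 b\<^sub>2 b\<^sub>3"
begin

lemma caputo_frac_poly:
  assumes "\<forall>x\<in>U. f x = frac_poly \<alpha> p x"
  shows "caputo \<alpha> U \<mu> f x = (\<Sum>m\<in>Poly_Mapping.keys p. Poly_Mapping.lookup p m * caputo_monomial \<alpha> \<mu> m x)"
proof -
  have "(THE p. \<forall>y\<in>U. f y = frac_poly \<alpha> p y) = p"
  proof (rule the_equality)
    fix q assume "\<forall>y\<in>U. f y = frac_poly \<alpha> q y"
    then show "q = p" using assms frac_poly_unique[OF pos, of q p] by (simp add: U)
  qed (fact assms)
  then show ?thesis by (simp add: caputo_def)
qed

lemma caputo_monomial_eq: "caputo \<alpha> U \<mu> (frac_monomial \<alpha> m) = caputo_monomial \<alpha> \<mu> m"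
proof
  fix x
  have "\<forall>x\<in>U. frac_monomial \<alpha> m x = frac_poly \<alpha> (Poly_Mapping.single m 1) x"
    by (simp add: frac_poly_def)
  from caputo_frac_poly[OF this]
  show "caputo \<alpha> U \<mu> (frac_monomial \<alpha> m) x = caputo_monomial \<alpha> \<mu> m x" by simp
qed

lemma caputo_add:
  assumes "f \<in> frac_poly_algebra \<alpha> U" "g \<in> frac_poly_algebra \<alpha> U"
  shows "caputo \<alpha> U \<mu> (f + g) = caputo \<alpha> U \<mu> f + caputo \<alpha> U \<mu> g"
proof
  fix x
  obtain p q where p: "\<forall>x\<in>U. f x = frac_poly \<alpha> p x" and q: "\<forall>x\<in>U. g x = frac_poly \<alpha> q x"
    using assms by (auto simp: frac_poly_algebra_def)
  have pq: "\<forall>x\<in>U. (f + g) x = frac_poly \<alpha> (p + q) x" using p q by (simp add: frac_poly_add)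
  let ?S = "Poly_Mapping.keys p \<union> Poly_Mapping.keys q" and ?D = "\<lambda>m. caputo_monomial \<alpha> \<mu> m x"
  have ext: "(\<Sum>m\<in>Poly_Mapping.keys r. Poly_Mapping.lookup r m * ?D m) = (\<Sum>m\<in>?S. Poly_Mapping.lookup r m * ?D m)" if "Poly_Mapping.keys r \<subseteq> ?S" for r
    using that by (intro sum.mono_neutral_left) (auto simp: in_keys_iff)
  have "Poly_Mapping.keys (p + q) \<subseteq> ?S" by (rule Poly_Mapping.keys_add)
  then show "caputo \<alpha> U \<mu> (f + g) x = (caputo \<alpha> U \<mu> f + caputo \<alpha> U \<mu> g) x"
    unfolding plus_fun_apply caputo_frac_poly[OF p] caputo_frac_poly[OF q] caputo_frac_poly[OF pq]
    by (subst (1 2 3) ext) (auto simp: lookup_add algebra_simps sum.distrib)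
qed

lemma caputo_scale:
  assumes "f \<in> frac_poly_algebra \<alpha> U"
  shows "caputo \<alpha> U \<mu> (\<lambda>x. c * f x) = (\<lambda>x. c * caputo \<alpha> U \<mu> f x)"
proof
  fix x
  obtain p where p: "\<forall>x\<in>U. f x = frac_poly \<alpha> p x"
    using assms by (auto simp: frac_poly_algebra_def)
  define q where "q = Poly_Mapping.map ((*) c) p"
  have lq: "Poly_Mapping.lookup q m = c * Poly_Mapping.lookup p m" for m
    by (simp add: q_def map.rep_eq when_def)
  have kq: "Poly_Mapping.keys q \<subseteq> Poly_Mapping.keys p" by (auto simp: in_keys_iff lq)
  have q: "\<forall>x\<in>U. c * f x = frac_poly \<alpha> q x"
    unfolding frac_poly_superset[OF finite_keys kq]
    using p by (simp add: frac_poly_def lq sum_distrib_left ac_simps)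
  have "(\<Sum>m\<in>Poly_Mapping.keys q. Poly_Mapping.lookup q m * caputo_monomial \<alpha> \<mu> m x)
      = (\<Sum>m\<in>Poly_Mapping.keys p. Poly_Mapping.lookup q m * caputo_monomial \<alpha> \<mu> m x)"
    using kq by (intro sum.mono_neutral_left) (auto simp: in_keys_iff)
  then show "caputo \<alpha> U \<mu> (\<lambda>x. c * f x) x = c * caputo \<alpha> U \<mu> f x"
    by (simp add: caputo_frac_poly[OF p] caputo_frac_poly[OF q] lq sum_distrib_left ac_simps)
qed

end

end

theory Submission
  imports Defs
begin

text \<open>
  Charge conservation is the identity \<open>d\<^sup>\<alpha> \<circ> d\<^sup>\<alpha> = 0\<close> applied to the form \<open>\<star>\<^sub>\<alpha> F\<close>: the
  inhomogeneous equation says that the current is \<open>d\<^sup>\<alpha> (\<star>\<^sub>\<alpha> F)\<close>, so it is closed.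

  The identity rests on two symmetries. Each fractional operator sends a monomial to a multiple of
  a monomial: it lowers one exponent by one and multiplies by a factor that depends on \<open>\<alpha>\<close> and on
  that exponent alone. Operators in different directions therefore act
  independently and commute on monomials, hence on all polynomials by linearity
  (\<open>caputo_commute\<close>). In \<open>d\<^sup>\<alpha> (d\<^sup>\<alpha> \<omega>)\<close> every mixed derivative occurs twice, once for each
  order in which the two generators are wedged on, and anticommutativity gives the two occurrences
  opposite signs (\<open>shuffle_sign_swap\<close>); they cancel in pairs (\<open>frac_d_frac_d\<close>).

  Fields are functions of which only the values on the box matter, so the argument also uses that
  \<open>d\<^sup>\<alpha>\<close> depends only on those values (\<open>frac_d_cong\<close>), and that the coefficients of
  \<open>\<star>\<^sub>\<alpha> F\<close> are again polynomials.

  For the equivalence with the continuity equation, \<open>d\<^sup>\<alpha>\<close> of the current has a single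
  component that can be nonzero, the one along \<open>e\<^sup>0\<^sup>1\<^sup>2\<^sup>3\<close>. Moving \<open>e\<^sup>\<mu>\<close> to its place in
  that component costs the sign \<open>(-1)\<^sup>\<mu>\<close>, which undoes the alternating signs in the definition
  of the current, and what remains is \<open>D\<^sub>t \<rho> + div J\<close> (\<open>frac_d_current_UNIV\<close>).
\<close>

section \<open>The algebra of fractional polynomials\<close>

lemma frac_poly_algebra_zero: "0 \<in> frac_poly_algebra \<alpha> U"
  unfolding frac_poly_algebra_def by (auto intro!: exI[of _ 0] simp: frac_poly_def)

lemma frac_poly_algebra_add:
  assumes "f \<in> frac_poly_algebra \<alpha> U" "g \<in> frac_poly_algebra \<alpha> U"
  shows "f + g \<in> frac_poly_algebra \<alpha> U"
proof -
  obtain p q where "\<forall>x\<in>U. f x = frac_poly \<alpha> p x" "\<forall>x\<in>U. g x = frac_poly \<alpha> q x"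
    using assms by (auto simp: frac_poly_algebra_def)
  then have "\<forall>x\<in>U. (f + g) x = frac_poly \<alpha> (p + q) x" by (simp add: frac_poly_add)
  then show ?thesis unfolding frac_poly_algebra_def by blast
qed

lemma frac_poly_algebra_scaled_monomial:
  "(\<lambda>x. c * frac_monomial \<alpha> m x) \<in> frac_poly_algebra \<alpha> U"
proof -
  have "c * frac_monomial \<alpha> m x = frac_poly \<alpha> (Poly_Mapping.single m c) x" for x
    by (simp add: frac_poly_def)
  then show ?thesis unfolding frac_poly_algebra_def by blast
qed

lemma frac_poly_algebra_scale:
  assumes "f \<in> frac_poly_algebra \<alpha> U"
  shows "(\<lambda>x. c * f x) \<in> frac_poly_algebra \<alpha> U"
proof -
  obtain p where p: "\<forall>x\<in>U. f x = frac_poly \<alpha> p x"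
    using assms by (auto simp: frac_poly_algebra_def)
  define q where "q = Poly_Mapping.map ((*) c) p"
  have lq: "Poly_Mapping.lookup q m = c * Poly_Mapping.lookup p m" for m
    by (simp add: q_def map.rep_eq when_def)
  have kq: "Poly_Mapping.keys q \<subseteq> Poly_Mapping.keys p" by (auto simp: in_keys_iff lq)
  have "\<forall>x\<in>U. c * f x = frac_poly \<alpha> q x"
    unfolding frac_poly_superset[OF finite_keys kq]
    using p by (simp add: frac_poly_def lq sum_distrib_left ac_simps)
  then show ?thesis unfolding frac_poly_algebra_def by blast
qed

lemma frac_poly_algebra_minus:
  assumes "f \<in> frac_poly_algebra \<alpha> U"
  shows "- f \<in> frac_poly_algebra \<alpha> U"
  using frac_poly_algebra_scale[OF assms, of "-1"] by (simp add: fun_Compl_def)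

lemma frac_poly_algebra_sum:
  assumes "\<And>i. i \<in> A \<Longrightarrow> f i \<in> frac_poly_algebra \<alpha> U"
  shows "(\<lambda>x. \<Sum>i\<in>A. f i x) \<in> frac_poly_algebra \<alpha> U"
  using assms
proof (induction A rule: infinite_finite_induct)
  case (insert a A)
  then have "f a + (\<lambda>x. \<Sum>i\<in>A. f i x) \<in> frac_poly_algebra \<alpha> U"
    by (intro frac_poly_algebra_add) auto
  then show ?case using insert.hyps by (simp add: plus_fun_def)
qed (use frac_poly_algebra_zero in \<open>simp_all add: zero_fun_def\<close>)

section \<open>Commuting Caputo operators\<close>

text \<open>The value 0 at exponent 0 makes the formula for the derivative of a monomial uniform: a
  monomial that is constant in a direction is killed by its weight, whatever exponent the truncated
  subtraction in \<open>lower_exponent\<close> leaves behind.\<close>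

definition caputo_weight :: "real \<Rightarrow> nat \<Rightarrow> real" where
  "caputo_weight \<alpha> n =
     (if n = 0 then 0
      else Gamma (real n * \<alpha> + 1) / (Gamma ((real n - 1) * \<alpha> + 1) * Gamma (1 + \<alpha>)))"

definition lower_exponent :: "4 \<Rightarrow> nat^4 \<Rightarrow> nat^4" where
  "lower_exponent \<mu> m = (\<chi> \<nu>. if \<nu> = \<mu> then m $ \<nu> - 1 else m $ \<nu>)"

lemma lower_exponent_commute:
  "lower_exponent \<mu> (lower_exponent \<nu> m) = lower_exponent \<nu> (lower_exponent \<mu> m)"
  by (simp add: lower_exponent_def vec_eq_iff)

lemma caputo_monomial_weight:
  "caputo_monomial \<alpha> \<mu> m = (\<lambda>x. caputo_weight \<alpha> (m $ \<mu>) * frac_monomial \<alpha> (lower_exponent \<mu> m) x)"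
proof
  fix x
  have "frac_monomial \<alpha> (lower_exponent \<mu> m) x =
      frac_coord \<alpha> \<mu> x ^ (m $ \<mu> - 1) * (\<Prod>\<nu>\<in>UNIV - {\<mu>}. frac_coord \<alpha> \<nu> x ^ (m $ \<nu>))"
    unfolding frac_monomial_def
    by (subst prod.remove[where x = \<mu>]) (auto simp: lower_exponent_def intro!: prod.cong)
  then show "caputo_monomial \<alpha> \<mu> m x =
      caputo_weight \<alpha> (m $ \<mu>) * frac_monomial \<alpha> (lower_exponent \<mu> m) x"
    by (simp add: caputo_monomial_def caputo_weight_def)
qed

text \<open>The representing polynomial is selected by the values on \<open>U\<close> only. The conclusion is an
  equality everywhere, also outside \<open>U\<close>, because the result is computed from that polynomial.\<close>

lemma caputo_cong:
  assumes "\<And>x. x \<in> U \<Longrightarrow> f x = g x"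
  shows "caputo \<alpha> U \<mu> f = caputo \<alpha> U \<mu> g"
  using assms by (simp add: caputo_def fun_eq_iff cong: ball_cong)

text \<open>The side lengths have to be positive for the polynomial that represents a field on the box to
  be unique, and thus for the operators to be linear on the algebra.\<close>

locale fractional_box =
  fixes \<alpha> T b\<^sub>1 b\<^sub>2 b\<^sub>3 :: real and U :: "(real^4) set"
  assumes pos: "\<alpha> > 0" "T > 0" "b\<^sub>1 > 0" "b\<^sub>2 > 0" "b\<^sub>3 > 0"
    and U: "U = spacetime_box T b\<^sub>1 b\<^sub>2 b\<^sub>3"

context fractional_box
begin

lemma caputo_zero: "caputo \<alpha> U \<mu> 0 = 0"
proof -
  have "caputo \<alpha> U \<mu> (\<lambda>x. 0 * 0 x) = (\<lambda>x. 0 * caputo \<alpha> U \<mu> 0 x)"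
    by (rule caputo_scale[OF pos U frac_poly_algebra_zero])
  then show ?thesis by (simp add: zero_fun_def)
qed

lemma caputo_minus:
  assumes "f \<in> frac_poly_algebra \<alpha> U"
  shows "caputo \<alpha> U \<mu> (- f) = - caputo \<alpha> U \<mu> f"
  using caputo_scale[OF pos U assms, of \<mu> "-1"] by (simp add: fun_Compl_def)

lemma caputo_sum:
  assumes "\<And>i. i \<in> A \<Longrightarrow> f i \<in> frac_poly_algebra \<alpha> U"
  shows "caputo \<alpha> U \<mu> (\<lambda>x. \<Sum>i\<in>A. f i x) = (\<lambda>x. \<Sum>i\<in>A. caputo \<alpha> U \<mu> (f i) x)"
  using assms
proof (induction A rule: infinite_finite_induct)
  case (insert a A)
  have "caputo \<alpha> U \<mu> (\<lambda>x. \<Sum>i\<in>insert a A. f i x) = caputo \<alpha> U \<mu> (f a + (\<lambda>x. \<Sum>i\<in>A. f i x))"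
    using insert.hyps by (simp add: plus_fun_def)
  also have "\<dots> = caputo \<alpha> U \<mu> (f a) + caputo \<alpha> U \<mu> (\<lambda>x. \<Sum>i\<in>A. f i x)"
    using insert.prems by (intro caputo_add[OF pos U] frac_poly_algebra_sum) auto
  finally show ?case using insert by (simp add: plus_fun_def)
qed (use caputo_zero in \<open>simp_all add: zero_fun_def\<close>)

lemma caputo_scaled_monomial:
  "caputo \<alpha> U \<mu> (\<lambda>x. c * frac_monomial \<alpha> m x) =
     (\<lambda>x. (c * caputo_weight \<alpha> (m $ \<mu>)) * frac_monomial \<alpha> (lower_exponent \<mu> m) x)"
  using caputo_scale[OF pos U, of "frac_monomial \<alpha> m" \<mu> c]
    frac_poly_algebra_scaled_monomial[of 1 \<alpha> m U]
  by (simp add: caputo_monomial_eq[OF pos U] caputo_monomial_weight mult.assoc)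

lemma caputo_expansion:
  assumes "\<forall>x\<in>U. f x = frac_poly \<alpha> p x"
  shows "caputo \<alpha> U \<mu> f =
    (\<lambda>x. \<Sum>m\<in>Poly_Mapping.keys p. (Poly_Mapping.lookup p m * caputo_weight \<alpha> (m $ \<mu>))
        * frac_monomial \<alpha> (lower_exponent \<mu> m) x)"
  using caputo_frac_poly[OF pos U assms] by (simp add: fun_eq_iff caputo_monomial_weight mult.assoc)

lemma caputo_polynomial:
  assumes "f \<in> frac_poly_algebra \<alpha> U"
  shows "caputo \<alpha> U \<mu> f \<in> frac_poly_algebra \<alpha> U"
proof -
  obtain p where p: "\<forall>x\<in>U. f x = frac_poly \<alpha> p x"
    using assms by (auto simp: frac_poly_algebra_def)
  show ?thesis
    unfolding caputo_expansion[OF p] by (intro frac_poly_algebra_sum frac_poly_algebra_scaled_monomial)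
qed

text \<open>For \<open>\<mu> \<noteq> \<nu>\<close>, lowering the exponent of \<open>Z\<^sub>\<nu>\<close> leaves that of \<open>Z\<^sub>\<mu>\<close> alone, so both
  orders multiply a monomial by the same two weights and arrive at the same exponents.\<close>

lemma caputo_commute:
  assumes "f \<in> frac_poly_algebra \<alpha> U"
  shows "caputo \<alpha> U \<mu> (caputo \<alpha> U \<nu> f) = caputo \<alpha> U \<nu> (caputo \<alpha> U \<mu> f)"
proof (cases "\<mu> = \<nu>")
  case False
  obtain p where p: "\<forall>x\<in>U. f x = frac_poly \<alpha> p x"
    using assms by (auto simp: frac_poly_algebra_def)
  have "caputo \<alpha> U \<mu> (caputo \<alpha> U \<nu> f) =
      (\<lambda>x. \<Sum>m\<in>Poly_Mapping.keys p. (Poly_Mapping.lookup p m * caputo_weight \<alpha> (m $ \<nu>)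
        * caputo_weight \<alpha> (m $ \<mu>)) * frac_monomial \<alpha> (lower_exponent \<mu> (lower_exponent \<nu> m)) x)"
    if "\<mu> \<noteq> \<nu>" for \<mu> \<nu>
    using that
    by (simp add: caputo_expansion[OF p] caputo_sum frac_poly_algebra_scaled_monomial
        caputo_scaled_monomial, simp add: lower_exponent_def)
  then show ?thesis using False by (simp add: lower_exponent_commute[of \<mu> \<nu>] mult_ac)
qed simp

end

section \<open>The fractional exterior derivative squares to zero\<close>

lemma shuffle_sign_singleton: "shuffle_sign {\<mu>} I = (-1) ^ card {j \<in> I. j < \<mu>}"
proof -
  have "{(i, j). i \<in> {\<mu>} \<and> j \<in> I \<and> j < i} = Pair \<mu> ` {j \<in> I. j < \<mu>}" by auto
  then have "card {(i, j). i \<in> {\<mu>} \<and> j \<in> I \<and> j < i} = card {j \<in> I. j < \<mu>}"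
    by (simp only: card_image inj_on_def) (simp add: card_image inj_on_def)
  then show ?thesis by (simp only: shuffle_sign_def)
qed

text \<open>The sign form of \<open>e\<^sup>\<mu> \<and> e\<^sup>\<nu> = - e\<^sup>\<nu> \<and> e\<^sup>\<mu>\<close>: pulling \<open>\<mu>\<close> and then \<open>\<nu>\<close> to the
  front of the sorted \<open>K\<close> differs by one transposition from pulling them in the other order. If
  \<open>\<mu> < \<nu>\<close>, removing \<open>\<nu>\<close> does not change how many elements \<open>\<mu>\<close> has to pass, whereas removing
  \<open>\<mu>\<close> saves \<open>\<nu>\<close> exactly one.\<close>

lemma shuffle_sign_swap:
  assumes "\<mu> \<in> K" "\<nu> \<in> K" "\<mu> \<noteq> \<nu>"
  shows "shuffle_sign {\<mu>} (K - {\<mu>}) * shuffle_sign {\<nu>} (K - {\<mu>} - {\<nu>}) =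
     - (shuffle_sign {\<nu>} (K - {\<nu>}) * shuffle_sign {\<mu>} (K - {\<nu>} - {\<mu>}))"
proof -
  have *: "shuffle_sign {\<mu>} (K - {\<mu>}) * shuffle_sign {\<nu>} (K - {\<mu>} - {\<nu>}) =
     - (shuffle_sign {\<nu>} (K - {\<nu>}) * shuffle_sign {\<mu>} (K - {\<nu>} - {\<mu>}))"
    if "\<mu> \<in> K" "\<mu> < \<nu>" for \<mu> \<nu>
  proof -
    have same: "{j \<in> K - {\<mu>}. j < \<mu>} = {j \<in> K - {\<nu>} - {\<mu>}. j < \<mu>}"
      using that(2) by auto
    have "{j \<in> K - {\<nu>}. j < \<nu>} = insert \<mu> {j \<in> K - {\<mu>} - {\<nu>}. j < \<nu>}"
      using that by auto
    then have step: "card {j \<in> K - {\<nu>}. j < \<nu>} = Suc (card {j \<in> K - {\<mu>} - {\<nu>}. j < \<nu>})"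
      by simp
    show ?thesis unfolding shuffle_sign_singleton same step by simp
  qed
  show ?thesis
    using *[of \<mu> \<nu>] *[of \<nu> \<mu>] assms by (cases \<mu> \<nu> rule: linorder_cases) auto
qed

text \<open>Exchanging the two summation indices turns the sum into its negative.\<close>

lemma antisymmetric_sum_zero:
  fixes g :: "'a \<Rightarrow> 'a \<Rightarrow> real"
  assumes "\<And>i j. i \<in> K \<Longrightarrow> j \<in> K \<Longrightarrow> i \<noteq> j \<Longrightarrow> g i j = - g j i" and "finite K"
  shows "(\<Sum>i\<in>K. \<Sum>j\<in>K - {i}. g i j) = 0"
proof -
  \<comment> \<open>Filling the diagonal with zeros makes both index sets \<open>K\<close>, so that the sums can be swapped.\<close>
  define h where "h i j = (if i = j then 0 else g i j)" for i j
  have rows: "(\<Sum>j\<in>K - {i}. g i j) = (\<Sum>j\<in>K. h i j)" if "i \<in> K" for i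
  proof -
    have "(\<Sum>j\<in>K. h i j) = h i i + (\<Sum>j\<in>K - {i}. h i j)"
      using that assms(2) by (rule sum.remove[rotated])
    also have "\<dots> = (\<Sum>j\<in>K - {i}. g i j)"
      by (simp add: h_def) (rule sum.cong, auto)
    finally show ?thesis by simp
  qed
  have "(\<Sum>i\<in>K. \<Sum>j\<in>K - {i}. g i j) = (\<Sum>i\<in>K. \<Sum>j\<in>K. h i j)"
    by (simp add: rows)
  also have "\<dots> = (\<Sum>i\<in>K. \<Sum>j\<in>K. h j i)"
    by (rule sum.swap)
  also have "\<dots> = (\<Sum>i\<in>K. \<Sum>j\<in>K. - h i j)"
  proof (intro sum.cong refl)
    show "h j i = - h i j" if "i \<in> K" "j \<in> K" for i j
      using that assms(1)[of i j] by (simp add: h_def)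
  qed
  also have "\<dots> = - (\<Sum>i\<in>K. \<Sum>j\<in>K - {i}. g i j)"
    by (simp add: sum_negf rows)
  finally show ?thesis by simp
qed

lemma sum_fun_apply: "(\<Sum>i\<in>A. f i) x = (\<Sum>i\<in>A. f i x :: 'b :: comm_monoid_add)"
  by (induction A rule: infinite_finite_induct) auto

text \<open>Only \<open>e\<^sup>\<mu> \<and> e\<^sup>I\<close> with \<open>\<mu> \<in> K\<close> and \<open>I = K - {\<mu>}\<close> is a multiple of
  \<open>e\<^sup>K\<close>.\<close>

lemma frac_d_component:
  "frac_d \<alpha> U \<omega> K x =
     (\<Sum>\<mu>\<in>K. shuffle_sign {\<mu>} (K - {\<mu>}) * caputo \<alpha> U \<mu> (\<omega> (K - {\<mu>})) x)"
proof -
  let ?c = "\<lambda>\<mu> I. shuffle_sign {\<mu>} I * caputo \<alpha> U \<mu> (\<omega> I) x"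
  have "(caputo \<alpha> U \<mu> (\<omega> I) \<odot> (\<e> \<mu> \<^bold>\<and> basis_form I)) K x =
      (if I = K - {\<mu>} then if \<mu> \<in> K then ?c \<mu> I else 0 else 0)" for \<mu> I
    unfolding gen_def basis_wedge_basis by (auto simp: form_scale_def basis_form_def)
  then have "frac_d \<alpha> U \<omega> K x =
      (\<Sum>I\<in>UNIV. \<Sum>\<mu>\<in>UNIV. if I = K - {\<mu>} then if \<mu> \<in> K then ?c \<mu> I else 0 else 0)"
    by (simp add: frac_d_def sum_fun_apply)
  also have "\<dots> = (\<Sum>\<mu>\<in>UNIV. if \<mu> \<in> K then ?c \<mu> (K - {\<mu>}) else 0)"
    by (subst sum.swap) (simp add: sum.delta)
  also have "\<dots> = (\<Sum>\<mu>\<in>K. ?c \<mu> (K - {\<mu>}))"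
    by (simp add: sum.If_cases)
  finally show ?thesis .
qed

lemma frac_d_cong: "form_eq_on U \<omega> \<eta> \<Longrightarrow> frac_d \<alpha> U \<omega> = frac_d \<alpha> U \<eta>"
  by (auto simp: form_eq_on_def fun_eq_iff frac_d_component intro!: sum.cong
      fun_cong[OF caputo_cong])

text \<open>Linearity and commutation of the operators are properties on the algebra: a field outside it has no
  representing polynomial, and its derivative is an arbitrary default value.\<close>

definition polynomial_form :: "real \<Rightarrow> (real^4) set \<Rightarrow> form \<Rightarrow> bool" where
  "polynomial_form \<alpha> U \<omega> \<longleftrightarrow> (\<forall>I. \<omega> I \<in> frac_poly_algebra \<alpha> U)"

lemma polynomial_form_add:
  "polynomial_form \<alpha> U \<omega> \<Longrightarrow> polynomial_form \<alpha> U \<eta> \<Longrightarrow> polynomial_form \<alpha> U (\<omega> + \<eta>)"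
  by (simp add: polynomial_form_def frac_poly_algebra_add)

lemma polynomial_form_diff:
  "polynomial_form \<alpha> U \<omega> \<Longrightarrow> polynomial_form \<alpha> U \<eta> \<Longrightarrow> polynomial_form \<alpha> U (\<omega> - \<eta>)"
  unfolding polynomial_form_def
  by (metis diff_conv_add_uminus fun_diff_def frac_poly_algebra_add frac_poly_algebra_minus)

lemma polynomial_form_scaled_basis:
  assumes "f \<in> frac_poly_algebra \<alpha> U"
  shows "polynomial_form \<alpha> U (f \<odot> basis_form I)" "polynomial_form \<alpha> U (f \<odot> - basis_form I)"
proof -
  have "f * 0 = 0" "f * 1 = f" "f * - 1 = - f" by (auto simp: fun_eq_iff)
  then show "polynomial_form \<alpha> U (f \<odot> basis_form I)" "polynomial_form \<alpha> U (f \<odot> - basis_form I)"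
    using assms frac_poly_algebra_zero frac_poly_algebra_minus
    by (auto simp: polynomial_form_def form_scale_def basis_form_def)
qed

context fractional_box
begin

text \<open>Expanded in components, the coefficient of \<open>e\<^sup>K\<close> is a sum over ordered pairs of distinct
  indices in \<open>K\<close>. The second derivative in each term is symmetric in the pair and its sign
  antisymmetric.\<close>

lemma frac_d_frac_d:
  assumes "polynomial_form \<alpha> U \<omega>"
  shows "frac_d \<alpha> U (frac_d \<alpha> U \<omega>) = 0"
proof (intro ext)
  fix K x
  define D where "D = caputo \<alpha> U"
  have \<omega>: "\<omega> I \<in> frac_poly_algebra \<alpha> U" for I
    using assms by (simp add: polynomial_form_def)
  let ?s = "\<lambda>\<mu> I. shuffle_sign {\<mu>} (I - {\<mu>})"
  have step: "D \<mu> (frac_d \<alpha> U \<omega> I) x = (\<Sum>\<nu>\<in>I. ?s \<nu> I * D \<mu> (D \<nu> (\<omega> (I - {\<nu>}))) x)" for \<mu> I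
  proof -
    have "frac_d \<alpha> U \<omega> I = (\<lambda>x. \<Sum>\<nu>\<in>I. ?s \<nu> I * D \<nu> (\<omega> (I - {\<nu>})) x)"
      by (simp add: fun_eq_iff frac_d_component D_def)
    then show ?thesis
      unfolding D_def
      by (simp add: caputo_sum frac_poly_algebra_scale caputo_polynomial \<omega> caputo_scale[OF pos U])
  qed
  let ?g = "\<lambda>\<mu> \<nu>. ?s \<mu> K * ?s \<nu> (K - {\<mu>}) * D \<mu> (D \<nu> (\<omega> (K - {\<mu>} - {\<nu>}))) x"
  have "frac_d \<alpha> U (frac_d \<alpha> U \<omega>) K x = (\<Sum>\<mu>\<in>K. \<Sum>\<nu>\<in>K - {\<mu>}. ?g \<mu> \<nu>)"
    unfolding frac_d_component[of \<alpha> U "frac_d \<alpha> U \<omega>"] D_def[symmetric] step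
    by (simp add: sum_distrib_left mult.assoc)
  also have "\<dots> = 0"
  proof (rule antisymmetric_sum_zero)
    fix \<mu> \<nu> assume *: "\<mu> \<in> K" "\<nu> \<in> K" "\<mu> \<noteq> \<nu>"
    have "K - {\<mu>} - {\<nu>} = K - {\<nu>} - {\<mu>}" by auto
    moreover have "D \<mu> (D \<nu> (\<omega> I)) = D \<nu> (D \<mu> (\<omega> I))" for I
      unfolding D_def by (rule caputo_commute[OF \<omega>])
    ultimately show "?g \<mu> \<nu> = - ?g \<nu> \<mu>"
      using shuffle_sign_swap[OF *] by simp
  qed simp
  finally show "frac_d \<alpha> U (frac_d \<alpha> U \<omega>) K x = 0 K x" by simp
qed

end

section \<open>The Maxwell forms\<close>

lemma index4_less: "(0::4) < 1" "(0::4) < 2" "(0::4) < 3" "(1::4) < 2" "(1::4) < 3" "(2::4) < 3"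
  using index4_order by (auto intro: less_trans)

lemmas gen_wedge_increasing = index4_less[THEN gen_wedge_gen(1)]

lemma polynomial_form_faraday:
  assumes "\<forall>i. E $ i \<in> frac_poly_algebra \<alpha> U" "\<forall>i. B $ i \<in> frac_poly_algebra \<alpha> U"
  shows "polynomial_form \<alpha> U (faraday E B)"
  unfolding faraday_def gen_wedge_increasing
  using assms
  by (intro polynomial_form_add polynomial_form_diff polynomial_form_scaled_basis
      frac_poly_algebra_minus) auto

lemma polynomial_form_hodge2:
  assumes "polynomial_form \<alpha> U \<omega>"
  shows "polynomial_form \<alpha> U (hodge2 \<omega>)"
  unfolding hodge2_def gen_wedge_increasing
  using assms unfolding polynomial_form_def[of \<alpha> U \<omega>]
  by (intro polynomial_form_add polynomial_form_scaled_basis) auto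

text \<open>The four index sets are the complements \<open>UNIV - {\<mu>}\<close>, hence all the sets with three
  elements.\<close>

lemma current_components:
  "current \<rho> J {1, 2, 3} = \<rho>" "current \<rho> J {0, 2, 3} = - (J $ 1)"
  "current \<rho> J {0, 1, 3} = J $ 2" "current \<rho> J {0, 1, 2} = - (J $ 3)"
  "card I \<noteq> 3 \<Longrightarrow> current \<rho> J I = 0"
proof -
  have ne: "{1, 2, 3} \<noteq> {0, 2, 3::4}" "{1, 2, 3} \<noteq> {0, 1, 3::4}" "{1, 2, 3} \<noteq> {0, 1, 2::4}"
    "{0, 2, 3} \<noteq> {0, 1, 3::4}" "{0, 2, 3} \<noteq> {0, 1, 2::4}" "{0, 1, 3} \<noteq> {0, 1, 2::4}"
    by (simp_all add: set_eq_subset)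
  have card: "card {1, 2, 3::4} = 3" "card {0, 2, 3::4} = 3" "card {0, 1, 3::4} = 3"
    "card {0, 1, 2::4} = 3" by auto
  note simps = current_def index4_less gen_wedge_gen_gen form_scale_def basis_form_def
    fun_eq_iff
  show "current \<rho> J {1, 2, 3} = \<rho>" "current \<rho> J {0, 2, 3} = - (J $ 1)"
    "current \<rho> J {0, 1, 3} = J $ 2" "current \<rho> J {0, 1, 2} = - (J $ 3)"
    using ne ne[symmetric] by (simp_all add: simps)
  show "current \<rho> J I = 0" if "card I \<noteq> 3"
  proof -
    have "I \<noteq> {1, 2, 3}" "I \<noteq> {0, 2, 3}" "I \<noteq> {0, 1, 3}" "I \<noteq> {0, 1, 2}"
      using that card by metis+
    then show ?thesis by (simp add: simps)
  qed
qed

context fractional_box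
begin

text \<open>In the component along \<open>e\<^sup>0\<^sup>1\<^sup>2\<^sup>3\<close> the \<open>\<mu>\<close>-derivative falls on the coefficient of the
  complement of \<open>\<mu>\<close>, with sign \<open>(-1)\<^sup>\<mu>\<close> since \<open>\<mu>\<close> has \<open>\<mu>\<close> predecessors. For
  \<open>\<mu> = 1, 3\<close> this sign meets the minus sign of \<open>J\<^sub>\<mu>\<close> in the current.\<close>

lemma frac_d_current_UNIV:
  assumes "\<forall>i. J $ i \<in> frac_poly_algebra \<alpha> U"
  shows "frac_d \<alpha> U (current \<rho> J) UNIV x = (caputo \<alpha> U 0 \<rho> + frac_div \<alpha> U J) x"
proof -
  have compl: "UNIV - {0::4} = {1, 2, 3}" "UNIV - {1::4} = {0, 2, 3}"
    "UNIV - {2::4} = {0, 1, 3}" "UNIV - {3::4} = {0, 1, 2}"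
    unfolding index4_UNIV by auto
  have below: "{j \<in> {1, 2, 3}. j < (0::4)} = {}" "{j \<in> {0, 2, 3}. j < (1::4)} = {0}"
    "{j \<in> {0, 1, 3}. j < (2::4)} = {0, 1}" "{j \<in> {0, 1, 2}. j < (3::4)} = {0, 1, 2}"
    using index4_less by (auto dest: less_asym)
  have signs: "shuffle_sign {0} {1, 2, 3} = 1" "shuffle_sign {1} {0, 2, 3} = -1"
    "shuffle_sign {2} {0, 1, 3} = 1" "shuffle_sign {3} {0, 1, 2} = -1"
    by (simp_all only: shuffle_sign_singleton below) simp_all
  have four: "(\<Sum>\<mu>\<in>UNIV. h \<mu>) = h 0 + h 1 + h 2 + h 3" for h :: "4 \<Rightarrow> real"
    unfolding index4_UNIV by simp
  show ?thesis
    unfolding frac_d_component four compl signs current_components frac_div_def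
    using assms by (simp add: caputo_minus)
qed

text \<open>The current has degree three, so its derivative has degree four.\<close>

lemma frac_d_current_proper:
  assumes "K \<noteq> UNIV"
  shows "frac_d \<alpha> U (current \<rho> J) K x = 0"
proof -
  have "card K < card (UNIV :: 4 set)"
    using assms by (intro psubset_card_mono) auto
  then have "card (K - {\<mu>}) \<noteq> 3" if "\<mu> \<in> K" for \<mu>
    using that by simp
  then show ?thesis
    unfolding frac_d_component by (simp add: current_components(5) caputo_zero)
qed

lemma frac_d_current_zero_iff:
  assumes "\<forall>i. J $ i \<in> frac_poly_algebra \<alpha> U"
  shows "form_eq_on U (frac_d \<alpha> U (current \<rho> J)) 0 \<longleftrightarrow>
     (\<forall>x\<in>U. (caputo \<alpha> U 0 \<rho> + frac_div \<alpha> U J) x = 0)"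
  unfolding form_eq_on_def
  by (metis frac_d_current_UNIV[OF assms] frac_d_current_proper zero_fun_def)

end

theorem theorem7p5:
  fixes \<alpha> T b\<^sub>1 b\<^sub>2 b\<^sub>3 :: real and U :: "(real^4) set"
    and E B J :: "scalar_field^3" and \<rho> :: scalar_field
  assumes "0 < \<alpha>" "\<alpha> < 1" and "T > 0" "b\<^sub>1 > 0" "b\<^sub>2 > 0" "b\<^sub>3 > 0"
    and "U = spacetime_box T b\<^sub>1 b\<^sub>2 b\<^sub>3"
    and "\<forall>i. E $ i \<in> frac_poly_algebra \<alpha> U" "\<forall>i. B $ i \<in> frac_poly_algebra \<alpha> U"
    and "\<rho> \<in> frac_poly_algebra \<alpha> U" "\<forall>i. J $ i \<in> frac_poly_algebra \<alpha> U"
  shows "(form_eq_on U (frac_d \<alpha> U (faraday E B)) 0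
             \<and> form_eq_on U (frac_d \<alpha> U (hodge2 (faraday E B))) (current \<rho> J)
          \<longrightarrow> form_eq_on U (frac_d \<alpha> U (current \<rho> J)) 0)
       \<and> (form_eq_on U (frac_d \<alpha> U (current \<rho> J)) 0
          \<longleftrightarrow> (\<forall>x\<in>U. (caputo \<alpha> U 0 \<rho> + frac_div \<alpha> U J) x = 0))"
proof -
  interpret fractional_box \<alpha> T b\<^sub>1 b\<^sub>2 b\<^sub>3 U
    by (rule fractional_box.intro) (fact assms)+
  show ?thesis
  proof (intro conjI impI)
    let ?G = "hodge2 (faraday E B)"
    assume "form_eq_on U (frac_d \<alpha> U (faraday E B)) 0
        \<and> form_eq_on U (frac_d \<alpha> U ?G) (current \<rho> J)"
    then have "frac_d \<alpha> U (frac_d \<alpha> U ?G) = frac_d \<alpha> U (current \<rho> J)"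
      by (intro frac_d_cong) blast
    moreover have "frac_d \<alpha> U (frac_d \<alpha> U ?G) = 0"
      using assms(8,9) by (intro frac_d_frac_d polynomial_form_hodge2 polynomial_form_faraday)
    ultimately show "form_eq_on U (frac_d \<alpha> U (current \<rho> J)) 0"
      by (simp add: form_eq_on_def)
  next
    show "form_eq_on U (frac_d \<alpha> U (current \<rho> J)) 0
        \<longleftrightarrow> (\<forall>x\<in>U. (caputo \<alpha> U 0 \<rho> + frac_div \<alpha> U J) x = 0)"
      using frac_d_current_zero_iff[OF assms(11)] .
  qed
qed

end
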